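(* Let $k$ be a positive integer, $p$ a positive real number, and $f:\mathbb N\to\mathbb C$ a function. For real $x\ge 1$ and $t\in\mathbb R$ let $$S_k(x,t)=\sum_{1\le n\le x}f(n)e^{2\pi i n^kt},\qquad F_{k,p}(t)=\sum_{n=1}^\infty\frac{f(n)e^{2\pi i n^kt}}{n^p}.$$ Assume that for some positive constants $C$ and $\alpha$ with $\max(0,p-k)<\alpha<p$ we have $$|S_k(x,t)|\le Cx^{\alpha}\quad\text{for all real } x\ge1 \text{ and all } t\in\mathbb R.$$ Then $$|F_{k,p}(t+h)-F_{k,p}(t)|\le C_2h^{(p-\alpha)/k}\quad\text{for all } t\in\mathbb R \text{ and } h>0,$$ where $$C_2=\frac{6\pi C\left(\alpha+k-p+|k-p|\right)k^2}{(\alpha+k-p)^2(p-\alpha)}.$$ Moreover, the same conclusion holds with $F_{k,p}(t)$ replaced by each of the functions $|F_{k,p}(t)|$, $\operatorname{Re}F_{k,p}(t)$, and $\operatorname{Im}F_{k,p}(t)$. In particular, the functions $F_{k,p}(t)$, $|F_{k,p}(t)|$, $\operatorname{Re}F_{k,p}(t)$, and $\operatorname{Im}F_{k,p}(t)$ are Hölder continuous with exponent $(p-\alpha)/k$.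
   Context: $\mathbb N=\{1,2,3,\dots\}$. The infinite series defining $F_{k,p}(t)$ is understood as the limit of its partial sums $\sum_{n=1}^N$ as $N\to\infty$; under the hypothesis of the claim this limit exists for every $t\in\mathbb R$. A function $g$ is Hölder continuous with exponent $\eta\in(0,1)$ if there is a constant $K>0$ such that $|g(x)-g(y)|\le K|x-y|^\eta$ for all $x,y$ in its domain (here $\mathbb R$; the functions are $1$-periodic). *)

theory Defs
  imports "HOL-Analysis.Analysis"
begin

text \<open>
  Arithmetic functions on the positive integers are modelled as functions on \<^typ>\<open>nat\<close>; the
  value at \<open>0\<close> is never used.
\<close>

definition exp_sum :: "(nat \<Rightarrow> complex) \<Rightarrow> nat \<Rightarrow> real \<Rightarrow> real \<Rightarrow> complex" where
  "exp_sum f k x t =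
     (\<Sum>n | 1 \<le> n \<and> real n \<le> x. f n * exp (2 * of_real pi * \<i> * of_nat (n ^ k) * of_real t))"

definition series_term :: "(nat \<Rightarrow> complex) \<Rightarrow> nat \<Rightarrow> real \<Rightarrow> real \<Rightarrow> nat \<Rightarrow> complex" where
  "series_term f k p t n =
     f n * exp (2 * of_real pi * \<i> * of_nat (n ^ k) * of_real t) / of_real (real n powr p)"

text \<open>
  \<^const>\<open>suminf\<close> is the limit of the partial sums (not an unconditional sum); the index is
  shifted because the series starts at \<open>n = 1\<close>.
\<close>

definition F_series :: "(nat \<Rightarrow> complex) \<Rightarrow> nat \<Rightarrow> real \<Rightarrow> real \<Rightarrow> complex" where
  "F_series f k p t = (\<Sum>n. series_term f k p t (Suc n))"

definition holder_const :: "nat \<Rightarrow> real \<Rightarrow> real \<Rightarrow> real \<Rightarrow> real" where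
  "holder_const k p \<alpha> C =
     6 * pi * C * (\<alpha> + real k - p + \<bar>real k - p\<bar>) * (real k)\<^sup>2 /
       ((\<alpha> + real k - p)\<^sup>2 * (p - \<alpha>))"

definition holder_continuous :: "real \<Rightarrow> (real \<Rightarrow> 'a::metric_space) \<Rightarrow> bool" where
  "holder_continuous \<eta> g \<longleftrightarrow>
     0 < \<eta> \<and> \<eta> < 1 \<and> (\<exists>K>0. \<forall>x y. dist (g x) (g y) \<le> K * \<bar>x - y\<bar> powr \<eta>)"

end

theory Submission
  imports Defs
begin

text \<open>
  Split the series at \<open>x = h powr (- 1 / k)\<close>. Summation by parts against the bound on the
  exponential sums estimates the derivative of the head by a multiple of \<open>x powr (\<alpha> + k - p)\<close>
  and each of the two tails by a multiple of \<open>x powr (\<alpha> - p)\<close>; after multiplying the former by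
  \<open>h\<close>, both become multiples of \<open>h powr ((p - \<alpha>) / k)\<close>.
\<close>

section \<open>Partial summation against powers of n\<close>

text \<open>The left side is \<open>a powr \<alpha>\<close> times |s| times the integral of
  \<open>u powr (s - 1)\<close> over [a, b]; since \<alpha> \<ge> 0, \<open>a powr \<alpha>\<close>
  may be replaced by \<open>u powr \<alpha>\<close> under the integral. The resulting bound
  telescopes over consecutive integers. The sign of \<open>s + \<alpha>\<close> is left open because
  the head of the series needs it positive and the tails need it negative.\<close>

lemma powr_increment_bound:
  fixes a b s \<alpha> :: real
  assumes "0 < a" "a \<le> b" "0 \<le> \<alpha>" "s + \<alpha> \<noteq> 0"
  shows "a powr \<alpha> * \<bar>b powr s - a powr s\<bar> \<le> \<bar>s\<bar> * (b powr (s + \<alpha>) - a powr (s + \<alpha>)) / (s + \<alpha>)"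
proof -
  \<comment> \<open>Monotonicity in the upper endpoint replaces integration; the two values of
    \<sigma> give the two signs of the absolute value.\<close>
  have mono: "\<bar>s\<bar> * a powr (s + \<alpha>) / (s + \<alpha>) + \<sigma> * a powr \<alpha> * a powr s
      \<le> \<bar>s\<bar> * b powr (s + \<alpha>) / (s + \<alpha>) + \<sigma> * a powr \<alpha> * b powr s" if \<sigma>: "\<bar>\<sigma>\<bar> = 1" for \<sigma> :: real
  proof (rule DERIV_nonneg_imp_nondecreasing[OF assms(2)])
    fix u assume u: "a \<le> u" "u \<le> b"
    then have u0: "0 < u" using assms by simp
    let ?d = "\<bar>s\<bar> * u powr (s + \<alpha> - 1) + \<sigma> * a powr \<alpha> * (s * u powr (s - 1))"
    have "((\<lambda>u. \<bar>s\<bar> * u powr (s + \<alpha>) / (s + \<alpha>) + \<sigma> * a powr \<alpha> * u powr s) has_real_derivative ?d) (at u)"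
      using u0 assms(4) by (auto intro!: derivative_eq_intros)
    moreover have "0 \<le> ?d"
    proof -
      have "\<bar>\<sigma> * a powr \<alpha> * (s * u powr (s - 1))\<bar> = \<bar>s\<bar> * (a powr \<alpha> * u powr (s - 1))"
        by (simp add: abs_mult \<sigma>)
      also have "\<dots> \<le> \<bar>s\<bar> * (u powr \<alpha> * u powr (s - 1))"
        using u assms by (intro mult_left_mono mult_right_mono powr_mono2) auto
      also have "\<dots> = \<bar>s\<bar> * u powr (s + \<alpha> - 1)"
        by (simp add: powr_add[symmetric] algebra_simps)
      finally show ?thesis by linarith
    qed
    ultimately show "\<exists>y. ((\<lambda>u. \<bar>s\<bar> * u powr (s + \<alpha>) / (s + \<alpha>) + \<sigma> * a powr \<alpha> * u powr s)
        has_real_derivative y) (at u) \<and> 0 \<le> y" by blast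
  qed
  have "a powr \<alpha> * \<bar>b powr s - a powr s\<bar> = \<bar>a powr \<alpha> * b powr s - a powr \<alpha> * a powr s\<bar>"
    by (simp add: abs_mult right_diff_distrib[symmetric])
  also have "\<dots> \<le> \<bar>s\<bar> * b powr (s + \<alpha>) / (s + \<alpha>) - \<bar>s\<bar> * a powr (s + \<alpha>) / (s + \<alpha>)"
    using mono[of 1] mono[of "-1"] by simp
  finally show ?thesis by (simp add: right_diff_distrib diff_divide_distrib)
qed

text \<open>All partial sums start at 1 rather than at \<open>m\<close>, since only such sums are
  controlled by the hypothesis on the exponential sums. The price is the boundary term at
  \<open>m\<close>, which is zero for \<open>m = 1\<close>.\<close>

lemma summation_by_parts:
  fixes a g :: "nat \<Rightarrow> 'a :: comm_ring_1"
  assumes "1 \<le> m" "m \<le> N"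
  shows "(\<Sum>n=m..N. a n * g n) =
    sum a {1..N} * g N - sum a {1..m-1} * g m - (\<Sum>n=m..<N. sum a {1..n} * (g (Suc n) - g n))"
  using assms(2)
proof (induction N rule: dec_induct)
  case base
  obtain l where "m = Suc l" using assms(1) by (cases m) auto
  then show ?case by (simp add: algebra_simps)
next
  case (step N)
  then show ?case by (simp add: algebra_simps)
qed

text \<open>Summation by parts, with every increment of \<open>n powr s\<close> estimated so that
  the sum telescopes. The boundary term at \<open>m\<close> is kept as it is: it vanishes for the
  head and is estimated separately for the tails.\<close>

lemma sum_times_powr_bound:
  fixes a :: "nat \<Rightarrow> complex" and s \<alpha> C :: real
  assumes A: "\<And>n. n \<ge> 1 \<Longrightarrow> norm (sum a {1..n}) \<le> C * real n powr \<alpha>"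
    and "0 \<le> \<alpha>" "s + \<alpha> \<noteq> 0" "1 \<le> m" "m \<le> N"
  shows "norm (\<Sum>n=m..N. a n * of_real (real n powr s)) \<le>
    C * real N powr (s + \<alpha>) + norm (sum a {1..m-1}) * real m powr s
    + C * \<bar>s\<bar> * (real N powr (s + \<alpha>) - real m powr (s + \<alpha>)) / (s + \<alpha>)"
proof -
  define g where "g n = (of_real (real n powr s) :: complex)" for n
  \<comment> \<open>At \<open>n = 1\<close> the power on the right is 1, so the hypothesis itself
    forces this sign.\<close>
  have C: "0 \<le> C" using order_trans[OF norm_ge_zero A[of 1]] by simp
  have 1: "norm (sum a {1..N} * g N) \<le> C * real N powr (s + \<alpha>)"
    using mult_right_mono[OF A[of N], of "real N powr s"] assms
    by (simp add: g_def norm_mult powr_add mult_ac)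
  have 2: "norm (sum a {1..m-1} * g m) = norm (sum a {1..m-1}) * real m powr s"
    by (simp add: g_def norm_mult)
  have "norm (\<Sum>n=m..<N. sum a {1..n} * (g (Suc n) - g n))
      \<le> (\<Sum>n=m..<N. C * \<bar>s\<bar> / (s + \<alpha>) * (real (Suc n) powr (s + \<alpha>) - real n powr (s + \<alpha>)))"
  proof (rule sum_norm_le)
    fix n assume "n \<in> {m..<N}"
    then have n: "n \<ge> 1" using assms by auto
    have "norm (sum a {1..n} * (g (Suc n) - g n))
        = norm (sum a {1..n}) * \<bar>real (Suc n) powr s - real n powr s\<bar>"
      by (simp only: g_def norm_mult of_real_diff[symmetric] norm_of_real)
    also have "\<dots> \<le> C * real n powr \<alpha> * \<bar>real (Suc n) powr s - real n powr s\<bar>"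
      using A[OF n] by (intro mult_right_mono) auto
    also have "\<dots> \<le> C * (\<bar>s\<bar> * (real (Suc n) powr (s + \<alpha>) - real n powr (s + \<alpha>)) / (s + \<alpha>))"
      unfolding mult.assoc using n assms C
      by (intro mult_left_mono powr_increment_bound) auto
    finally show "norm (sum a {1..n} * (g (Suc n) - g n))
      \<le> C * \<bar>s\<bar> / (s + \<alpha>) * (real (Suc n) powr (s + \<alpha>) - real n powr (s + \<alpha>))" by simp
  qed
  also have "\<dots> = C * \<bar>s\<bar> / (s + \<alpha>) * (real N powr (s + \<alpha>) - real m powr (s + \<alpha>))"
    unfolding sum_distrib_left[symmetric] using assms(5)
    by (subst sum_Suc_diff'[of m N "\<lambda>n. real n powr (s + \<alpha>)"]) auto
  finally have 3: "norm (\<Sum>n=m..<N. sum a {1..n} * (g (Suc n) - g n))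
      \<le> C * \<bar>s\<bar> * (real N powr (s + \<alpha>) - real m powr (s + \<alpha>)) / (s + \<alpha>)" by simp
  have "(\<Sum>n=m..N. a n * of_real (real n powr s)) = (\<Sum>n=m..N. a n * g n)"
    by (simp add: g_def)
  also have "\<dots> = sum a {1..N} * g N - sum a {1..m-1} * g m - (\<Sum>n=m..<N. sum a {1..n} * (g (Suc n) - g n))"
    using assms by (intro summation_by_parts)
  also have "norm \<dots> \<le> norm (sum a {1..N} * g N) + norm (sum a {1..m-1} * g m)
      + norm (\<Sum>n=m..<N. sum a {1..n} * (g (Suc n) - g n))"
    by (intro order_trans[OF norm_triangle_ineq4] add_right_mono norm_triangle_ineq4)
  finally show ?thesis
    using 1 2 3 by linarith
qed

lemma initial_sum_times_powr_bound:
  fixes a :: "nat \<Rightarrow> complex" and s \<alpha> C :: real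
  assumes A: "\<And>n. n \<ge> 1 \<Longrightarrow> norm (sum a {1..n}) \<le> C * real n powr \<alpha>"
    and "0 \<le> \<alpha>" "s + \<alpha> > 0"
  shows "norm (\<Sum>n=1..N. a n * of_real (real n powr s)) \<le>
    C * (s + \<alpha> + \<bar>s\<bar>) / (s + \<alpha>) * real N powr (s + \<alpha>)"
proof (cases "N = 0")
  case False
  have C: "0 \<le> C" using order_trans[OF norm_ge_zero A[of 1]] by simp
  have "norm (\<Sum>n=1..N. a n * of_real (real n powr s)) \<le>
      C * real N powr (s + \<alpha>) + C * \<bar>s\<bar> * (real N powr (s + \<alpha>) - 1) / (s + \<alpha>)"
    using sum_times_powr_bound[of a C \<alpha> s 1 N] A assms False by simp
  also have "\<dots> \<le> C * real N powr (s + \<alpha>) + C * \<bar>s\<bar> * real N powr (s + \<alpha>) / (s + \<alpha>)"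
    using assms C by (intro add_left_mono divide_right_mono mult_left_mono) auto
  finally show ?thesis using assms by (simp add: field_simps)
qed simp

text \<open>The case \<open>s = - p\<close>, where \<open>s + \<alpha>\<close> is negative. The
  bound does not depend on \<open>N\<close>, so it yields both convergence of the series and an
  estimate of its remainder.\<close>

lemma tail_sum_times_powr_bound:
  fixes a :: "nat \<Rightarrow> complex" and p \<alpha> C :: real
  assumes A: "\<And>n. n \<ge> 1 \<Longrightarrow> norm (sum a {1..n}) \<le> C * real n powr \<alpha>"
    and "0 < \<alpha>" "\<alpha> < p" "1 \<le> m"
  shows "norm (\<Sum>n=m..N. a n * of_real (real n powr - p)) \<le> C * (1 + p / (p - \<alpha>)) * real m powr (\<alpha> - p)"
proof (cases "m \<le> N")
  case True
  have C: "0 \<le> C" using order_trans[OF norm_ge_zero A[of 1]] by simp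
  have "norm (sum a {1..m-1}) \<le> C * real m powr \<alpha>"
  \<comment> \<open>The hypothesis says nothing about the empty sum, which occurs exactly for
    \<open>m = 1\<close>.\<close>
  proof (cases "m = 1")
    case False
    then have "norm (sum a {1..m-1}) \<le> C * real (m - 1) powr \<alpha>" using assms(4) by (intro A) auto
    also have "\<dots> \<le> C * real m powr \<alpha>" using assms C by (intro mult_left_mono powr_mono2) auto
    finally show ?thesis .
  qed (use C in simp)
  then have "norm (sum a {1..m-1}) * real m powr - p \<le> C * real m powr \<alpha> * real m powr - p"
    by (intro mult_right_mono) auto
  also have "\<dots> = C * real m powr (\<alpha> - p)" by (simp add: powr_diff powr_minus_divide)
  finally have bd: "norm (sum a {1..m-1}) * real m powr - p \<le> C * real m powr (\<alpha> - p)" .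
  have "norm (\<Sum>n=m..N. a n * of_real (real n powr - p)) \<le>
      C * real N powr (\<alpha> - p) + norm (sum a {1..m-1}) * real m powr - p
      + C * p * (real N powr (\<alpha> - p) - real m powr (\<alpha> - p)) / (\<alpha> - p)"
    using sum_times_powr_bound[of a C \<alpha> "- p" m N] A assms True by simp
  also have "\<dots> = C * real N powr (\<alpha> - p) * (1 - p / (p - \<alpha>)) + norm (sum a {1..m-1}) * real m powr - p
      + C * p / (p - \<alpha>) * real m powr (\<alpha> - p)"
    using assms by (simp add: divide_simps) (simp add: algebra_simps)
  \<comment> \<open>The coefficient \<open>1 - p / (p - \<alpha>)\<close> equals
    \<open>- \<alpha> / (p - \<alpha>)\<close>, which is negative, so the term in \<open>N\<close>
    is discarded.\<close>
  also have "\<dots> \<le> 0 + C * real m powr (\<alpha> - p) + C * p / (p - \<alpha>) * real m powr (\<alpha> - p)"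
    using assms C by (intro add_mono bd order_refl mult_nonneg_nonpos) (auto simp: divide_simps)
  finally show ?thesis by (simp add: algebra_simps)
next
  case False
  have "0 \<le> C" using order_trans[OF norm_ge_zero A[of 1]] by simp
  then show ?thesis using False assms by simp
qed

text \<open>The uniform bound on blocks tends to 0, which is the Cauchy criterion; letting the upper
  end of a block tend to infinity carries the bound over to the remainder. With the index shift, the
  first \<open>M\<close> terms are those with n from 1 to \<open>M\<close>, so the remainder starts
  at \<open>Suc M\<close>.\<close>

lemma summable_times_powr_and_tail_bound:
  fixes a :: "nat \<Rightarrow> complex" and p \<alpha> C :: real
  assumes A: "\<And>n. n \<ge> 1 \<Longrightarrow> norm (sum a {1..n}) \<le> C * real n powr \<alpha>"
    and "0 < \<alpha>" "\<alpha> < p"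
  defines "T \<equiv> \<lambda>n. a (Suc n) * of_real (real (Suc n) powr - p)"
  shows "summable T"
    and "norm (suminf T - sum T {..<M}) \<le> C * (1 + p / (p - \<alpha>)) * real (Suc M) powr (\<alpha> - p)"
proof -
  define B where "B = C * (1 + p / (p - \<alpha>))"
  have tail: "norm (sum T {m..<N}) \<le> B * real (Suc m) powr (\<alpha> - p)" for m N
  proof -
    have "sum T {m..<N} = (\<Sum>n=Suc m..N. a n * of_real (real n powr - p))"
      unfolding T_def using sum.shift_bounds_Suc_ivl[of "\<lambda>n. a n * of_real (real n powr - p)" m N]
      by (simp add: atLeastLessThanSuc_atLeastAtMost)
    then show ?thesis
      using tail_sum_times_powr_bound[of a C \<alpha> p "Suc m" N] A assms(2,3) by (simp add: B_def)
  qed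
  have "(\<lambda>m. B * real (Suc m) powr (\<alpha> - p)) \<longlonglongrightarrow> B * 0"
    using assms(3) by (intro tendsto_mult tendsto_const tendsto_neg_powr
        filterlim_compose[OF filterlim_real_sequentially filterlim_Suc]) auto
  then have lim: "(\<lambda>m. B * real (Suc m) powr (\<alpha> - p)) \<longlonglongrightarrow> 0" by simp
  show summable: "summable T"
    unfolding summable_Cauchy
  proof (intro allI impI)
    fix e :: real assume "e > 0"
    from order_tendstoD(2)[OF lim this] obtain N where
      "\<And>m. m \<ge> N \<Longrightarrow> B * real (Suc m) powr (\<alpha> - p) < e" by (auto simp: eventually_sequentially)
    then show "\<exists>N. \<forall>m\<ge>N. \<forall>n. norm (sum T {m..<n}) < e"
      using tail by (meson order_le_less_trans)
  qed
  have "norm (sum T {..<N} - sum T {..<M}) \<le> B * real (Suc M) powr (\<alpha> - p)" if "N \<ge> M" for N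
  proof -
    have "sum T {..<N} - sum T {..<M} = sum T {M..<N}"
      using sum_diff_nat_ivl[of 0 M N T] that by (simp add: lessThan_atLeast0)
    then show ?thesis using tail by simp
  qed
  moreover have "(\<lambda>N. norm (sum T {..<N} - sum T {..<M})) \<longlonglongrightarrow> norm (suminf T - sum T {..<M})"
    by (intro tendsto_intros summable_LIMSEQ[OF summable])
  ultimately have "norm (suminf T - sum T {..<M}) \<le> B * real (Suc M) powr (\<alpha> - p)"
    by (intro Lim_bounded[of _ _ M "B * real (Suc M) powr (\<alpha> - p)"]) blast+
  then show "norm (suminf T - sum T {..<M}) \<le> C * (1 + p / (p - \<alpha>)) * real (Suc M) powr (\<alpha> - p)"
    by (simp add: B_def)
qed

section \<open>Increments of the head of the series\<close>

lemma exp_sum_of_nat: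
  "exp_sum f k (real n) t = (\<Sum>i=1..n. f i * exp (2 * of_real pi * \<i> * of_nat (i ^ k) * of_real t))"
  unfolding exp_sum_def by (intro sum.cong) auto

lemma series_term_eq:
  "series_term f k p t n =
    f n * exp (2 * of_real pi * \<i> * of_nat (n ^ k) * of_real t) * of_real (real n powr - p)"
  by (simp add: series_term_def powr_minus divide_inverse)

text \<open>Mean value inequality on the real line: differentiating in t brings down a factor 2 pi i
  n^k, which turns the weight n^(-p) into n^(k - p), and the sum with that weight is estimated by
  \<open>initial_sum_times_powr_bound\<close>.\<close>

lemma head_increment_bound:
  fixes f :: "nat \<Rightarrow> complex"
  assumes S: "\<And>n t. n \<ge> 1 \<Longrightarrow> cmod (exp_sum f k (real n) t) \<le> C * real n powr \<alpha>"
    and "0 < \<alpha>" "p - real k < \<alpha>" "0 \<le> h"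
  shows "cmod ((\<Sum>n=1..M. series_term f k p (t + h) n) - (\<Sum>n=1..M. series_term f k p t n))
    \<le> 2 * pi * C * (\<alpha> + real k - p + \<bar>real k - p\<bar>) / (\<alpha> + real k - p) * real M powr (\<alpha> + real k - p) * h"
proof -
  \<comment> \<open>The argument is complex so that field derivatives within the convex set of reals
    can be used; the bound on the derivative is available only there.\<close>
  define E where "E n z = exp (2 * of_real pi * \<i> * of_nat (n ^ k) * z)" for n :: nat and z :: complex
  define \<phi> where "\<phi> z = (\<Sum>n=1..M. f n * E n z * of_real (real n powr - p))" for z
  define \<phi>' where "\<phi>' z = 2 * of_real pi * \<i> * (\<Sum>n=1..M. f n * E n z * of_real (real n powr (real k - p)))" for z
  have \<phi>: "(\<Sum>n=1..M. series_term f k p u n) = \<phi> (of_real u)" for u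
    by (simp add: series_term_eq \<phi>_def E_def)
  have der: "(\<phi> has_field_derivative \<phi>' z) (at z within \<real>)" for z
  proof -
    have "(\<phi> has_field_derivative (\<Sum>n=1..M. f n * (E n z * (2 * of_real pi * \<i> * of_nat (n ^ k)))
        * of_real (real n powr - p))) (at z within \<real>)"
      unfolding \<phi>_def E_def by (auto intro!: derivative_eq_intros sum.cong)
    also have "(\<Sum>n=1..M. f n * (E n z * (2 * of_real pi * \<i> * of_nat (n ^ k))) * of_real (real n powr - p)) = \<phi>' z"
      unfolding \<phi>'_def sum_distrib_left
    proof (rule sum.cong[OF refl])
      fix n assume "n \<in> {1..M}"
      then have "real n powr (real k - p) = real (n ^ k) * real n powr - p"
        by (simp add: diff_conv_add_uminus powr_add powr_realpow del: add_uminus_conv_diff)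
      then show "f n * (E n z * (2 * of_real pi * \<i> * of_nat (n ^ k))) * of_real (real n powr - p)
          = 2 * of_real pi * \<i> * (f n * E n z * of_real (real n powr (real k - p)))"
        by (simp add: mult_ac)
    qed
    finally show ?thesis .
  qed
  define D where "D = 2 * pi * C * (\<alpha> + real k - p + \<bar>real k - p\<bar>) / (\<alpha> + real k - p) * real M powr (\<alpha> + real k - p)"
  have bound: "norm (\<phi>' z) \<le> D" if "z \<in> \<real>" for z
  proof -
    from that obtain u where u: "z = of_real u" by (auto elim: Reals_cases)
    have "norm (\<Sum>n=1..M. f n * E n z * of_real (real n powr (real k - p))) \<le>
        C * (real k - p + \<alpha> + \<bar>real k - p\<bar>) / (real k - p + \<alpha>) * real M powr (real k - p + \<alpha>)"
      using assms S[of _ u]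
      by (intro initial_sum_times_powr_bound) (auto simp: exp_sum_of_nat E_def u)
    then have "2 * pi * norm (\<Sum>n=1..M. f n * E n z * of_real (real n powr (real k - p))) \<le> 2 * pi * (
        C * (real k - p + \<alpha> + \<bar>real k - p\<bar>) / (real k - p + \<alpha>) * real M powr (real k - p + \<alpha>))"
      by (intro mult_left_mono) auto
    then show ?thesis by (simp add: \<phi>'_def D_def norm_mult algebra_simps)
  qed
  have "norm (\<phi> (of_real (t + h)) - \<phi> (of_real t)) \<le> D * norm (of_real (t + h) - of_real t :: complex)"
    by (rule field_differentiable_bound[OF convex_Reals der bound]) auto
  then show ?thesis unfolding \<phi> using assms by (simp add: D_def)
qed

section \<open>The constant and the passage to Hoelder continuity\<close>

text \<open>The first summand comes from the head, the second from the two tails. In the variables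
  \<beta> = \<alpha> + k - p and \<delta> = p - \<alpha> one has k = \<beta> + \<delta>, and
  clearing denominators leaves a polynomial inequality that follows from \<alpha> \<le> E and
  \<beta> \<le> E.\<close>

lemma holder_const_bound:
  assumes "0 < C" "0 < \<alpha>" "p - real k < \<alpha>" "\<alpha> < p"
  shows "2 * pi * C * (\<alpha> + real k - p + \<bar>real k - p\<bar>) / (\<alpha> + real k - p) + 2 * (C * (1 + p / (p - \<alpha>)))
    \<le> holder_const k p \<alpha> C"
proof -
  define \<beta> where "\<beta> = \<alpha> + real k - p"
  define \<delta> where "\<delta> = p - \<alpha>"
  define E where "E = \<beta> + \<bar>real k - p\<bar>"
  have pos: "0 < \<beta>" "0 < \<delta>" using assms by (auto simp: \<beta>_def \<delta>_def)
  have E: "\<alpha> \<le> E" "\<beta> \<le> E" by (auto simp: E_def \<beta>_def)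
  have k: "real k = \<beta> + \<delta>" and p: "p = \<alpha> + \<delta>" by (auto simp: \<beta>_def \<delta>_def)
  have "2 * pi * E * \<beta> * \<delta> + 2 * (\<alpha> + 2 * \<delta>) * \<beta>\<^sup>2 \<le> 6 * pi * E * (\<beta> + \<delta>)\<^sup>2"
  proof -
    have "\<alpha> * \<beta>\<^sup>2 \<le> E * \<beta>\<^sup>2" "\<delta> * \<beta> * \<beta> \<le> \<delta> * \<beta> * E"
      using E pos by (auto intro!: mult_left_mono mult_right_mono)
    then have "2 * (\<alpha> + 2 * \<delta>) * \<beta>\<^sup>2 \<le> E * (2 * \<beta>\<^sup>2 + 4 * \<beta> * \<delta>)"
      by (simp add: algebra_simps power2_eq_square)
    \<comment> \<open>A factor pi > 1 is inserted so that this term can be merged with the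
      contribution of the head.\<close>
    also have "\<dots> \<le> pi * E * (2 * \<beta>\<^sup>2 + 4 * \<beta> * \<delta>)"
      using pos E pi_gt3 by (intro mult_right_mono) (auto simp: field_simps)
    also have "2 * pi * E * \<beta> * \<delta> + \<dots> = pi * E * (2 * \<beta>\<^sup>2 + 6 * \<beta> * \<delta>)" by (simp add: algebra_simps)
    also have "\<dots> \<le> pi * E * (6 * (\<beta> + \<delta>)\<^sup>2)"
      using pos E by (intro mult_left_mono) (auto simp: power2_sum algebra_simps)
    finally show ?thesis by (simp add: algebra_simps)
  qed
  then have "(2 * pi * E * \<beta> * \<delta> + 2 * (\<alpha> + 2 * \<delta>) * \<beta>\<^sup>2) / (\<beta>\<^sup>2 * \<delta>)
      \<le> 6 * pi * E * (\<beta> + \<delta>)\<^sup>2 / (\<beta>\<^sup>2 * \<delta>)"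
    using pos by (intro divide_right_mono) auto
  moreover have "(2 * pi * E * \<beta> * \<delta> + 2 * (\<alpha> + 2 * \<delta>) * \<beta>\<^sup>2) / (\<beta>\<^sup>2 * \<delta>)
      = 2 * pi * E / \<beta> + 2 * (1 + p / \<delta>)"
    using pos by (simp add: p field_simps power2_eq_square)
  ultimately have "2 * pi * E / \<beta> + 2 * (1 + p / \<delta>) \<le> 6 * pi * E * (\<beta> + \<delta>)\<^sup>2 / (\<beta>\<^sup>2 * \<delta>)"
    by simp
  then have "C * (2 * pi * E / \<beta> + 2 * (1 + p / \<delta>)) \<le> C * (6 * pi * E * (\<beta> + \<delta>)\<^sup>2 / (\<beta>\<^sup>2 * \<delta>))"
    using assms by (intro mult_left_mono) auto
  then have "2 * pi * C * E / \<beta> + 2 * (C * (1 + p / \<delta>)) \<le> 6 * pi * C * E * (real k)\<^sup>2 / (\<beta>\<^sup>2 * \<delta>)"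
    unfolding k by (simp add: algebra_simps)
  then show ?thesis unfolding holder_const_def E_def \<beta>_def \<delta>_def .
qed

text \<open>Positive increments suffice because the distance is symmetric; for equal arguments both
  sides are 0.\<close>

lemma holder_continuousI:
  fixes g :: "real \<Rightarrow> 'a::metric_space"
  assumes "0 < \<eta>" "\<eta> < 1" "0 < K" and le: "\<And>t h. h > 0 \<Longrightarrow> dist (g (t + h)) (g t) \<le> K * h powr \<eta>"
  shows "holder_continuous \<eta> g"
  unfolding holder_continuous_def
proof (intro conjI exI[of _ K] allI)
  fix x y :: real
  consider "x < y" | "x = y" | "y < x" by linarith
  then show "dist (g x) (g y) \<le> K * \<bar>x - y\<bar> powr \<eta>"
  proof cases
    case 1
    then show ?thesis using le[of "y - x" x] by (simp add: dist_commute)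
  next
    case 3
    then show ?thesis using le[of "x - y" y] by simp
  qed simp
qed (use assms in auto)

section \<open>Balancing head and tails\<close>

theorem theorem1p3:
  fixes f :: "nat \<Rightarrow> complex" and k :: nat and p C \<alpha> :: real
  assumes "k > 0" and "p > 0" and "C > 0" and "\<alpha> > 0"
    and "max 0 (p - real k) < \<alpha>" and "\<alpha> < p"
    and "\<And>x t :: real. x \<ge> 1 \<Longrightarrow> cmod (exp_sum f k x t) \<le> C * x powr \<alpha>"
  shows "(\<forall>t. summable (\<lambda>n. series_term f k p t (Suc n))) \<and>
    (\<forall>t h. h > 0 \<longrightarrow>
       cmod (F_series f k p (t + h) - F_series f k p t)
         \<le> holder_const k p \<alpha> C * h powr ((p - \<alpha>) / real k)) \<and>
    (\<forall>t h. h > 0 \<longrightarrow>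
       \<bar>cmod (F_series f k p (t + h)) - cmod (F_series f k p t)\<bar>
         \<le> holder_const k p \<alpha> C * h powr ((p - \<alpha>) / real k)) \<and>
    (\<forall>t h. h > 0 \<longrightarrow>
       \<bar>Re (F_series f k p (t + h)) - Re (F_series f k p t)\<bar>
         \<le> holder_const k p \<alpha> C * h powr ((p - \<alpha>) / real k)) \<and>
    (\<forall>t h. h > 0 \<longrightarrow>
       \<bar>Im (F_series f k p (t + h)) - Im (F_series f k p t)\<bar>
         \<le> holder_const k p \<alpha> C * h powr ((p - \<alpha>) / real k)) \<and>
    holder_continuous ((p - \<alpha>) / real k) (\<lambda>t. F_series f k p t) \<and>
    holder_continuous ((p - \<alpha>) / real k) (\<lambda>t. cmod (F_series f k p t)) \<and>
    holder_continuous ((p - \<alpha>) / real k) (\<lambda>t. Re (F_series f k p t)) \<and>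
    holder_continuous ((p - \<alpha>) / real k) (\<lambda>t. Im (F_series f k p t))"
proof -
  define H where "H = holder_const k p \<alpha> C"
  define \<eta> where "\<eta> = (p - \<alpha>) / real k"
  have \<beta>: "0 < \<alpha> + real k - p" using assms by simp
  \<comment> \<open>The upper bound is the assumption p - k < \<alpha> in another form.\<close>
  have \<eta>: "0 < \<eta>" "\<eta> < 1" using assms by (auto simp: \<eta>_def)
  have S: "cmod (exp_sum f k (real n) t) \<le> C * real n powr \<alpha>" if "n \<ge> 1" for n t
    using assms(7)[of "real n" t] that by simp
  have S': "norm (\<Sum>i=1..n. f i * exp (2 * of_real pi * \<i> * of_nat (i ^ k) * of_real t)) \<le> C * real n powr \<alpha>"
    if "n \<ge> 1" for n t
    using S[OF that, of t] by (simp add: exp_sum_of_nat)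
  note tail = summable_times_powr_and_tail_bound[OF S' assms(4,6), folded series_term_eq]
  have summable: "summable (\<lambda>n. series_term f k p t (Suc n))" for t
    by (rule tail(1))
  have F: "cmod (F_series f k p (t + h) - F_series f k p t) \<le> H * h powr \<eta>" if h: "h > 0" for t h
  proof -
    \<comment> \<open>This choice makes \<open>h * x powr (\<alpha> + k - p)\<close> and
      \<open>x powr (\<alpha> - p)\<close> both equal to \<open>h powr \<eta>\<close>. For h > 1 the
      head is empty (\<open>M = 0\<close>), and the estimates below still hold.\<close>
    define x where "x = h powr (- 1 / real k)"
    define M where "M = nat \<lfloor>x\<rfloor>"
    define P where "P u = (\<Sum>n=1..M. series_term f k p u n)" for u
    define B where "B = C * (1 + p / (p - \<alpha>))"
    define D where "D = 2 * pi * C * (\<alpha> + real k - p + \<bar>real k - p\<bar>) / (\<alpha> + real k - p)"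
    have x: "x > 0" using h by (simp add: x_def)
    then have M: "real M \<le> x" "x \<le> real (Suc M)" unfolding M_def by linarith+
    have BD: "0 \<le> B" "0 \<le> D" using assms \<beta> by (auto simp: B_def D_def)
    have tail_le: "cmod (F_series f k p u - P u) \<le> B * h powr \<eta>" for u
    proof -
      have "P u = (\<Sum>n<M. series_term f k p u (Suc n))"
        unfolding P_def by (simp add: sum.atLeast1_atMost_eq)
      then have "cmod (F_series f k p u - P u) \<le> B * real (Suc M) powr (\<alpha> - p)"
        using tail(2)[of u M] by (simp add: F_series_def B_def)
      \<comment> \<open>The exponent is negative, so the lower bound \<open>x \<le> Suc M\<close> is
        the one needed; the head has a positive exponent and uses \<open>M \<le> x\<close>.\<close>
      also have "\<dots> \<le> B * x powr (\<alpha> - p)"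
        using x M assms BD by (intro mult_left_mono powr_mono2') auto
      also have "x powr (\<alpha> - p) = h powr (- 1 / real k * (\<alpha> - p))"
        by (simp only: x_def powr_powr)
      also have "- 1 / real k * (\<alpha> - p) = \<eta>"
        using assms(1) by (simp add: \<eta>_def field_simps)
      finally show ?thesis .
    qed
    have "cmod (P (t + h) - P t) \<le> D * real M powr (\<alpha> + real k - p) * h"
      unfolding P_def D_def using assms h S by (intro head_increment_bound) auto
    also have "\<dots> \<le> D * x powr (\<alpha> + real k - p) * h"
      using M BD \<beta> h by (intro mult_right_mono mult_left_mono powr_mono2) auto
    also have "\<dots> = D * (h powr (- 1 / real k * (\<alpha> + real k - p)) * h powr 1)"
      using h by (simp add: x_def powr_powr)
    also have "\<dots> = D * h powr (- 1 / real k * (\<alpha> + real k - p) + 1)"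
      by (simp only: powr_add)
    also have "- 1 / real k * (\<alpha> + real k - p) + 1 = \<eta>"
      using assms(1) by (simp add: \<eta>_def field_simps)
    finally have head_le: "cmod (P (t + h) - P t) \<le> D * h powr \<eta>" .
    have "F_series f k p (t + h) - F_series f k p t =
        (P (t + h) - P t) + ((F_series f k p (t + h) - P (t + h)) - (F_series f k p t - P t))"
      by simp
    also have "cmod \<dots> \<le> cmod (P (t + h) - P t)
        + (cmod (F_series f k p (t + h) - P (t + h)) + cmod (F_series f k p t - P t))"
      by (intro norm_triangle_le add_left_mono norm_triangle_ineq4)
    also have "\<dots> \<le> (D + 2 * B) * h powr \<eta>"
      using head_le tail_le[of t] tail_le[of "t + h"] by (simp add: algebra_simps)
    also have "\<dots> \<le> H * h powr \<eta>"
      unfolding D_def B_def H_def using assms by (intro mult_right_mono holder_const_bound) auto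
    finally show ?thesis .
  qed
  \<comment> \<open>Hoelder continuity asks for a strictly positive constant.\<close>
  have H: "H > 0" unfolding H_def holder_const_def using assms \<beta>
    by (intro divide_pos_pos mult_pos_pos add_pos_nonneg) auto
  have abs: "\<bar>cmod (F_series f k p (t + h)) - cmod (F_series f k p t)\<bar> \<le> H * h powr \<eta>"
    and Re: "\<bar>Re (F_series f k p (t + h)) - Re (F_series f k p t)\<bar> \<le> H * h powr \<eta>"
    and Im: "\<bar>Im (F_series f k p (t + h)) - Im (F_series f k p t)\<bar> \<le> H * h powr \<eta>"
    if "h > 0" for t h
    \<comment> \<open>The modulus, real part and imaginary part are 1-Lipschitz, so each inherits
      the bound for the series with the same constant.\<close>
    using F[OF that, of t] norm_triangle_ineq3[of "F_series f k p (t + h)" "F_series f k p t"]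
      abs_Re_le_cmod[of "F_series f k p (t + h) - F_series f k p t"]
      abs_Im_le_cmod[of "F_series f k p (t + h) - F_series f k p t"]
    by auto
  show ?thesis
    unfolding H_def[symmetric] \<eta>_def[symmetric]
    by (intro conjI allI impI summable F abs Re Im holder_continuousI[OF \<eta> H])
      (simp_all only: dist_norm real_norm_def F abs Re Im)
qed

end
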